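(* For $i=1,2$, let $\Lambda_i\subset(0,\infty)$ be a countable multiplicative subgroup, let $\Gamma_i\subset\mathbb{R}$ be a countable $\mathbb{Z}\Lambda_i$-module which is dense in $\mathbb{R}$, and let $\mathcal{S}_i:=\mathcal{S}(\Gamma_i,\Lambda_i)$ be the Stein groupoid. Suppose that there exists a continuous homomorphism $\Phi:\mathcal{S}_1\to\mathcal{S}_2$ which is injective and open. Then there exists a homomorphism $\phi:\Lambda_1\to\Lambda_2$ preserving the order, i.e. $\phi(\lambda)<\phi(\lambda')$ if and only if $\lambda<\lambda'$.
   Context: "$\Gamma\subset\mathbb{R}$ is a $\mathbb{Z}\Lambda$-module" means that $\Gamma$ is an additive subgroup of $\mathbb{R}$ with $\lambda\Gamma\subset\Gamma$ for all $\lambda\in\Lambda$. The space $\mathbb{R}_\Gamma$: as a set $\mathbb{R}_\Gamma=(\mathbb{R}\setminus\Gamma)\sqcup\{t_+,t_-\mid t\in\Gamma\}$, with the canonical surjection $q:\mathbb{R}_\Gamma\to\mathbb{R}$ ($q(t_\pm)=t$, $q(x)=x$ for $x\notin\Gamma$), the total order such that $q(x)<q(y)$ implies $x<y$ and $t_-<t_+$ for $t\in\Gamma$, and the order topology. It is totally disconnected and locally compact Hausdorff; the sets $[t_+,s_-]$ ($t<s$ in $\Gamma$) are compact open and form a basis. The group $\Gamma\rtimes\Lambda$ (with $(s,\lambda)(s',\lambda')=(s+\lambda s',\lambda\lambda')$) acts on $\mathbb{R}_\Gamma$ by $(s,\lambda)\cdot x=\lambda x+s$ for $x\in\mathbb{R}\setminus\Gamma$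 and $(s,\lambda)\cdot t_\pm=(\lambda t+s)_\pm$. For an action of a discrete group $G$ on $X$, the transformation groupoid $X\rtimes G$ is $X\times G$ with the product topology, unit space $X$ (identified with $X\times\{1\}$), $r(x,\gamma)=x$, $s(x,\gamma)=\gamma^{-1}x$, $(x,\gamma)(\gamma^{-1}x,\gamma')=(x,\gamma\gamma')$. The Stein groupoid is $\mathcal{S}(\Gamma,\Lambda):=\mathbb{R}_\Gamma\rtimes(\Gamma\rtimes\Lambda)$. *)

theory Defs
  imports "HOL-Analysis.Analysis" "HOL-Algebra.Group"
begin

section \<open>Groups of real numbers\<close>

definition real_add_group :: "real monoid" where
  "real_add_group = \<lparr>carrier = UNIV, mult = (+), one = 0\<rparr>"

definition pos_real_mult_group :: "real monoid" where
  "pos_real_mult_group = \<lparr>carrier = {0<..}, mult = (*), one = 1\<rparr>"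

definition Z_module :: "real set \<Rightarrow> real set \<Rightarrow> bool" where
  "Z_module \<Lambda> \<Gamma> \<longleftrightarrow>
     subgroup \<Gamma> real_add_group \<and> (\<forall>l\<in>\<Lambda>. \<forall>t\<in>\<Gamma>. l * t \<in> \<Gamma>)"

definition semidirect :: "real set \<Rightarrow> real set \<Rightarrow> (real \<times> real) monoid" where
  "semidirect \<Gamma> \<Lambda> =
     \<lparr>carrier = \<Gamma> \<times> \<Lambda>,
      mult = (\<lambda>(s, l) (s', l'). (s + l * s', l * l')),
      one = (0, 1)\<rparr>"

section \<open>The space of reals split along a subgroup\<close>

text \<open>\<open>Minus t\<close> and \<open>Plus t\<close> stand for $t_-$ and $t_+$, and \<open>Unsplit x\<close> for a point $x$ that is not
  split. Which of these symbols are points depends on \<open>\<Gamma>\<close>, see \<open>split_reals\<close>.\<close>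

datatype split_real = Unsplit real | Minus real | Plus real

definition split_reals :: "real set \<Rightarrow> split_real set" where
  "split_reals \<Gamma> = Unsplit ` (- \<Gamma>) \<union> Minus ` \<Gamma> \<union> Plus ` \<Gamma>"

fun split_proj :: "split_real \<Rightarrow> real" where
  "split_proj (Unsplit x) = x"
| "split_proj (Minus t) = t"
| "split_proj (Plus t) = t"

text \<open>A strict total order on each \<open>split_reals \<Gamma>\<close>, though not on the whole type.\<close>

definition split_less :: "split_real \<Rightarrow> split_real \<Rightarrow> bool" where
  "split_less x y \<longleftrightarrow>
     split_proj x < split_proj y \<or> (\<exists>t. x = Minus t \<and> y = Plus t)"

text \<open>The order topology. As \<open>split_reals \<Gamma>\<close> has neither a least nor a greatest element, the open
  rays cover it, so that it is the underlying set of the topology they generate.\<close>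

definition split_topology :: "real set \<Rightarrow> split_real topology" where
  "split_topology \<Gamma> = topology_generated_by
     ((\<lambda>a. {x \<in> split_reals \<Gamma>. split_less a x}) ` split_reals \<Gamma> \<union>
      (\<lambda>a. {x \<in> split_reals \<Gamma>. split_less x a}) ` split_reals \<Gamma>)"

fun split_act :: "real \<times> real \<Rightarrow> split_real \<Rightarrow> split_real" where
  "split_act (s, l) (Unsplit x) = Unsplit (l * x + s)"
| "split_act (s, l) (Minus t) = Minus (l * t + s)"
| "split_act (s, l) (Plus t) = Plus (l * t + s)"

section \<open>Groupoids\<close>

text \<open>Units are regarded as arrows, and \<open>gmult g h\<close> is meaningful only if \<open>gsource g = grange h\<close>.
  The set of arrows is the underlying set of \<open>gtop\<close>.\<close>

record 'g top_groupoid =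
  gtop :: "'g topology"
  grange :: "'g \<Rightarrow> 'g"
  gsource :: "'g \<Rightarrow> 'g"
  gmult :: "'g \<Rightarrow> 'g \<Rightarrow> 'g"

definition arrows :: "'g top_groupoid \<Rightarrow> 'g set" where
  "arrows S = topspace (gtop S)"

definition composable :: "'g top_groupoid \<Rightarrow> 'g \<Rightarrow> 'g \<Rightarrow> bool" where
  "composable S g h \<longleftrightarrow> g \<in> arrows S \<and> h \<in> arrows S \<and> gsource S g = grange S h"

definition groupoid_hom :: "'g top_groupoid \<Rightarrow> 'h top_groupoid \<Rightarrow> ('g \<Rightarrow> 'h) \<Rightarrow> bool" where
  "groupoid_hom S T \<Phi> \<longleftrightarrow>
     \<Phi> ` arrows S \<subseteq> arrows T \<and>
     (\<forall>g h. composable S g h \<longrightarrow>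
        composable T (\<Phi> g) (\<Phi> h) \<and> \<Phi> (gmult S g h) = gmult T (\<Phi> g) (\<Phi> h))"

definition transformation_groupoid ::
  "'x topology \<Rightarrow> ('a, 'b) monoid_scheme \<Rightarrow> ('a \<Rightarrow> 'x \<Rightarrow> 'x) \<Rightarrow> ('x \<times> 'a) top_groupoid" where
  "transformation_groupoid X G act =
     \<lparr>gtop = prod_topology X (discrete_topology (carrier G)),
      grange = (\<lambda>(x, \<gamma>). (x, \<one>\<^bsub>G\<^esub>)),
      gsource = (\<lambda>(x, \<gamma>). (act (inv\<^bsub>G\<^esub> \<gamma>) x, \<one>\<^bsub>G\<^esub>)),
      gmult = (\<lambda>(x, \<gamma>) (y, \<gamma>'). (x, \<gamma> \<otimes>\<^bsub>G\<^esub> \<gamma>'))\<rparr>"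

definition stein_groupoid ::
  "real set \<Rightarrow> real set \<Rightarrow> (split_real \<times> real \<times> real) top_groupoid" where
  "stein_groupoid \<Gamma> \<Lambda> =
     transformation_groupoid (split_topology \<Gamma>) (semidirect \<Gamma> \<Lambda>) split_act"

end

theory Submission imports Defs begin

text \<open>The point $0_+$ is fixed by every $(0,\lambda)$, and an arrow at $0_+$ is sent by \<open>\<Phi>\<close> to an
  arrow $(y, (s,\phi(\lambda)))$ that fixes the image \<open>y\<close> of $0_+$. The map \<open>\<phi>\<close> defined in this way
  is a homomorphism, and what has to be explained is why it respects the order. The reason is
  dynamical: whether \<open>\<lambda>\<close> exceeds 1 can be read off from the action near $0_+$, since
  $\lambda^{-n}x \to 0_+$ for \<open>x\<close> slightly to the right of $0_+$ if and only if
  $\lambda > 1$, and \<open>\<Phi>\<close> carries this behaviour to \<open>y\<close>.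

  In detail, a homomorphism between transformation groupoids is an equivariant map \<open>\<theta>\<close> of the unit
  spaces together with a cocycle; if it is continuous, then the cocycle is locally constant
  (\<open>cocycle_of_groupoid_hom\<close>, \<open>locally_constant_cocycle\<close>). So for fixed \<open>\<lambda> > 1\<close> one and the same
  group element $g = (s,\phi(\lambda))$ satisfies $\theta(\lambda^{-1}x) = g^{-1}\theta(x)$ for all
  \<open>x\<close> near $0_+$. Projected to the real line, $g^{-1}$ is the affine map with slope
  $1/\phi(\lambda)$ that fixes \<open>q y\<close>, whence
  $q\theta(\lambda^{-n}x) - q y = (q\theta(x) - q y)/\phi(\lambda)^n$. The left side tends to 0 by
  continuity, and since \<open>\<theta>\<close> is injective while the fibres of \<open>q\<close> are finite, \<open>x\<close> can be chosen such
  that \<open>q\<theta>(x) \<noteq> q y\<close>. Therefore $\phi(\lambda) > 1$ (\<open>expanding_cocycle_value\<close>), and a homomorphism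
  of ordered groups that sends elements above 1 to elements above 1 is strictly increasing.\<close>

section \<open>The groups\<close>

lemma group_real_add: "group real_add_group"
proof (rule groupI)
  fix x assume "x \<in> carrier real_add_group"
  then show "\<exists>y\<in>carrier real_add_group. y \<otimes>\<^bsub>real_add_group\<^esub> x = \<one>\<^bsub>real_add_group\<^esub>"
    by (intro bexI[of _ "- x"]) (auto simp: real_add_group_def)
qed (auto simp: real_add_group_def)

lemma inv_real_add: "inv\<^bsub>real_add_group\<^esub> x = - x"
  by (rule group.inv_equality[OF group_real_add]) (auto simp: real_add_group_def)

lemma group_pos_real_mult: "group pos_real_mult_group"
proof (rule groupI)
  fix x assume "x \<in> carrier pos_real_mult_group"
  then show "\<exists>y\<in>carrier pos_real_mult_group. y \<otimes>\<^bsub>pos_real_mult_group\<^esub> x = \<one>\<^bsub>pos_real_mult_group\<^esub>"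
    by (intro bexI[of _ "1 / x"]) (auto simp: pos_real_mult_group_def)
qed (auto simp: pos_real_mult_group_def)

lemma inv_pos_real_mult: "x > 0 \<Longrightarrow> inv\<^bsub>pos_real_mult_group\<^esub> x = 1 / x"
  by (rule group.inv_equality[OF group_pos_real_mult]) (auto simp: pos_real_mult_group_def)

lemma pos_subgroup:
  assumes "subgroup \<Lambda> pos_real_mult_group"
  shows "\<And>l. l \<in> \<Lambda> \<Longrightarrow> l > 0" and "1 \<in> \<Lambda>"
    and "\<And>l m. l \<in> \<Lambda> \<Longrightarrow> m \<in> \<Lambda> \<Longrightarrow> l * m \<in> \<Lambda>"
    and "\<And>l. l \<in> \<Lambda> \<Longrightarrow> 1 / l \<in> \<Lambda>"
proof -
  interpret subgroup \<Lambda> pos_real_mult_group by fact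
  show pos: "l > 0" if "l \<in> \<Lambda>" for l
    using subset that by (auto simp: pos_real_mult_group_def)
  show "1 \<in> \<Lambda>" using one_closed by (simp add: pos_real_mult_group_def)
  show "l * m \<in> \<Lambda>" if "l \<in> \<Lambda>" "m \<in> \<Lambda>" for l m
    using m_closed[OF that] by (simp add: pos_real_mult_group_def)
  show "1 / l \<in> \<Lambda>" if "l \<in> \<Lambda>" for l
    using m_inv_closed[OF that] by (simp add: inv_pos_real_mult pos that)
qed

lemma Z_moduleD:
  assumes "Z_module \<Lambda> \<Gamma>"
  shows "0 \<in> \<Gamma>" and "\<And>s t. s \<in> \<Gamma> \<Longrightarrow> t \<in> \<Gamma> \<Longrightarrow> s + t \<in> \<Gamma>"
    and "\<And>t. t \<in> \<Gamma> \<Longrightarrow> - t \<in> \<Gamma>"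
    and "\<And>l t. l \<in> \<Lambda> \<Longrightarrow> t \<in> \<Gamma> \<Longrightarrow> l * t \<in> \<Gamma>"
proof -
  interpret subgroup \<Gamma> real_add_group using assms by (simp add: Z_module_def)
  show "0 \<in> \<Gamma>" using one_closed by (simp add: real_add_group_def)
  show "s + t \<in> \<Gamma>" if "s \<in> \<Gamma>" "t \<in> \<Gamma>" for s t
    using m_closed[OF that] by (simp add: real_add_group_def)
  show "- t \<in> \<Gamma>" if "t \<in> \<Gamma>" for t
    using m_inv_closed[OF that] by (simp add: inv_real_add)
  show "l * t \<in> \<Gamma>" if "l \<in> \<Lambda>" "t \<in> \<Gamma>" for l t
    using assms that by (simp add: Z_module_def)
qed

lemma semidirect_simps [simp]:
  "carrier (semidirect \<Gamma> \<Lambda>) = \<Gamma> \<times> \<Lambda>"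
  "(s, l) \<otimes>\<^bsub>semidirect \<Gamma> \<Lambda>\<^esub> (s', l') = (s + l * s', l * l')"
  "\<one>\<^bsub>semidirect \<Gamma> \<Lambda>\<^esub> = (0, 1)"
  by (simp_all add: semidirect_def)

lemma semidirect_inverse_closed:
  assumes "subgroup \<Lambda> pos_real_mult_group" "Z_module \<Lambda> \<Gamma>" "s \<in> \<Gamma>" "l \<in> \<Lambda>"
  shows "(- (s / l), 1 / l) \<in> \<Gamma> \<times> \<Lambda>"
  using Z_moduleD(4)[OF assms(2) pos_subgroup(4)[OF assms(1,4)] assms(3)]
    Z_moduleD(3)[OF assms(2)] pos_subgroup(4)[OF assms(1,4)] by auto

lemma group_semidirect:
  assumes \<Lambda>: "subgroup \<Lambda> pos_real_mult_group" and \<Gamma>: "Z_module \<Lambda> \<Gamma>"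
  shows "group (semidirect \<Gamma> \<Lambda>)"
proof (rule groupI)
  fix g assume "g \<in> carrier (semidirect \<Gamma> \<Lambda>)"
  then obtain s l where g: "g = (s, l)" "s \<in> \<Gamma>" "l \<in> \<Lambda>" by auto
  show "\<exists>h\<in>carrier (semidirect \<Gamma> \<Lambda>). h \<otimes>\<^bsub>semidirect \<Gamma> \<Lambda>\<^esub> g = \<one>\<^bsub>semidirect \<Gamma> \<Lambda>\<^esub>"
    using semidirect_inverse_closed[OF \<Lambda> \<Gamma> g(2,3)] pos_subgroup(1)[OF \<Lambda> g(3)] g(1)
    by (intro bexI[of _ "(- (s / l), 1 / l)"]) auto
qed (auto simp: pos_subgroup[OF \<Lambda>] Z_moduleD[OF \<Gamma>] algebra_simps)

lemma inv_semidirect: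
  assumes \<Lambda>: "subgroup \<Lambda> pos_real_mult_group" and \<Gamma>: "Z_module \<Lambda> \<Gamma>"
    and "s \<in> \<Gamma>" "l \<in> \<Lambda>"
  shows "inv\<^bsub>semidirect \<Gamma> \<Lambda>\<^esub> (s, l) = (- (s / l), 1 / l)"
  using semidirect_inverse_closed[OF assms] pos_subgroup(1)[OF \<Lambda> assms(4)] assms(3,4)
  by (intro group.inv_equality[OF group_semidirect[OF \<Lambda> \<Gamma>]]) auto

section \<open>The split real line\<close>

lemma split_proj_surj:
  obtains z where "z \<in> split_reals \<Gamma>" and "split_proj z = a"
proof (cases "a \<in> \<Gamma>")
  case True
  then show ?thesis by (intro that[of "Minus a"]) (auto simp: split_reals_def)
next
  case False
  then show ?thesis by (intro that[of "Unsplit a"]) (auto simp: split_reals_def)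
qed

lemma finite_split_proj_fibre: "finite {z. split_proj z = a}"
proof (rule finite_subset)
  show "{z. split_proj z = a} \<subseteq> {Unsplit a, Minus a, Plus a}"
  proof
    fix z assume "z \<in> {z. split_proj z = a}"
    then show "z \<in> {Unsplit a, Minus a, Plus a}" by (cases z) auto
  qed
qed simp

lemma split_proj_act: "split_proj (split_act (s, l) z) = l * split_proj z + s"
  by (cases z) auto

lemma split_act_one: "split_act (0, 1) z = z"
  by (cases z) auto

lemma split_act_closed:
  assumes \<Lambda>: "subgroup \<Lambda> pos_real_mult_group" and \<Gamma>: "Z_module \<Lambda> \<Gamma>"
    and g: "g \<in> carrier (semidirect \<Gamma> \<Lambda>)" and z: "z \<in> split_reals \<Gamma>"
  shows "split_act g z \<in> split_reals \<Gamma>"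
proof -
  obtain s l where [simp]: "g = (s, l)" and sl: "s \<in> \<Gamma>" "l \<in> \<Lambda>"
    using g by auto
  have l: "l > 0" by (rule pos_subgroup(1)[OF \<Lambda> sl(2)])
  have "x \<in> \<Gamma>" if "l * x + s \<in> \<Gamma>" for x
  proof -
    have "1 / l * ((l * x + s) + - s) \<in> \<Gamma>"
      by (rule Z_moduleD(4)[OF \<Gamma> pos_subgroup(4)[OF \<Lambda> sl(2)]
            Z_moduleD(2)[OF \<Gamma> that Z_moduleD(3)[OF \<Gamma> sl(1)]]])
    then show ?thesis using l by simp
  qed
  moreover have "l * x + s \<in> \<Gamma>" if "x \<in> \<Gamma>" for x
    using that sl by (intro Z_moduleD[OF \<Gamma>])
  ultimately have "l * x + s \<in> \<Gamma> \<longleftrightarrow> x \<in> \<Gamma>" for x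
    by blast
  then show ?thesis
    using z by (cases z) (auto simp: split_reals_def)
qed

lemma topspace_split_topology [simp]: "topspace (split_topology \<Gamma>) = split_reals \<Gamma>"
proof
  show "topspace (split_topology \<Gamma>) \<subseteq> split_reals \<Gamma>"
    by (auto simp: split_topology_def topology_generated_by_topspace)
  show "split_reals \<Gamma> \<subseteq> topspace (split_topology \<Gamma>)"
  proof
    fix x assume x: "x \<in> split_reals \<Gamma>"
    obtain a where "a \<in> split_reals \<Gamma>" "split_proj a = split_proj x - 1"
      by (rule split_proj_surj)
    then show "x \<in> topspace (split_topology \<Gamma>)"
      using x by (auto simp: split_topology_def topology_generated_by_topspace split_less_def
          intro!: bexI[of _ a])
  qed
qed

lemma openin_split_rays:
  assumes "a \<in> split_reals \<Gamma>"
  shows "openin (split_topology \<Gamma>) {x \<in> split_reals \<Gamma>. split_less a x}"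
    and "openin (split_topology \<Gamma>) {x \<in> split_reals \<Gamma>. split_less x a}"
  unfolding split_topology_def using assms by (auto intro!: topology_generated_by_Basis)

text \<open>The open half-lines of the real line pull back to rays, with end point $a_+$ on the left and
  $a_-$ on the right if \<open>a\<close> is split.\<close>

lemma continuous_map_split_proj: "continuous_map (split_topology \<Gamma>) euclideanreal split_proj"
  unfolding continuous_map_upper_lower_semicontinuous_lt
proof (intro conjI allI)
  fix a :: real
  let ?l = "if a \<in> \<Gamma> then Plus a else Unsplit a"
  have "{x \<in> split_reals \<Gamma>. a < split_proj x} = {x \<in> split_reals \<Gamma>. split_less ?l x}"
    by (auto simp: split_less_def)
  moreover have "?l \<in> split_reals \<Gamma>" by (auto simp: split_reals_def)
  ultimately show "openin (split_topology \<Gamma>) {x \<in> topspace (split_topology \<Gamma>). a < split_proj x}"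
    using openin_split_rays(1) by fastforce
  let ?r = "if a \<in> \<Gamma> then Minus a else Unsplit a"
  have "{x \<in> split_reals \<Gamma>. split_proj x < a} = {x \<in> split_reals \<Gamma>. split_less x ?r}"
    by (auto simp: split_less_def)
  moreover have "?r \<in> split_reals \<Gamma>" by (auto simp: split_reals_def)
  ultimately show "openin (split_topology \<Gamma>) {x \<in> topspace (split_topology \<Gamma>). split_proj x < a}"
    using openin_split_rays(2) by fastforce
qed

text \<open>A ray that contains $t_+$ contains all points slightly to the right of it, and this property
  passes to unions and finite intersections. There is no counterpart on the left, where
  the ray of all points above $t_-$ is a neighbourhood of $t_+$ that contains no point below it.\<close>

lemma right_neighbourhood_of_Plus:
  assumes "openin (split_topology \<Gamma>) U" and "Plus t \<in> U"
  obtains e where "e > 0"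
    and "\<And>x. x \<in> split_reals \<Gamma> \<Longrightarrow> t < split_proj x \<Longrightarrow> split_proj x < t + e \<Longrightarrow> x \<in> U"
proof -
  let ?B = "(\<lambda>a. {x \<in> split_reals \<Gamma>. split_less a x}) ` split_reals \<Gamma> \<union>
      (\<lambda>a. {x \<in> split_reals \<Gamma>. split_less x a}) ` split_reals \<Gamma>"
  let ?P = "\<lambda>U. Plus t \<in> U \<longrightarrow>
    (\<exists>e>0. \<forall>x\<in>split_reals \<Gamma>. t < split_proj x \<longrightarrow> split_proj x < t + e \<longrightarrow> x \<in> U)"
  have "generate_topology_on ?B U"
    using assms(1) by (simp add: split_topology_def openin_topology_generated_by_iff)
  then have "?P U"
  proof induction
    case Empty
    then show ?case by simp
  next
    case (Int U V)
    show ?case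
    proof
      assume "Plus t \<in> U \<inter> V"
      then obtain d e where "d > 0" "e > 0"
        "\<forall>x\<in>split_reals \<Gamma>. t < split_proj x \<longrightarrow> split_proj x < t + d \<longrightarrow> x \<in> U"
        "\<forall>x\<in>split_reals \<Gamma>. t < split_proj x \<longrightarrow> split_proj x < t + e \<longrightarrow> x \<in> V"
        using Int.IH by auto
      then show "\<exists>e>0. \<forall>x\<in>split_reals \<Gamma>. t < split_proj x \<longrightarrow> split_proj x < t + e \<longrightarrow> x \<in> U \<inter> V"
        by (intro exI[of _ "min d e"]) auto
    qed
  next
    case (UN K)
    then show ?case by blast
  next
    case (Basis V)
    then consider a where "V = {x \<in> split_reals \<Gamma>. split_less a x}"
      | a where "V = {x \<in> split_reals \<Gamma>. split_less x a}"
      by blast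
    then show ?case
    proof cases
      case 1
      show ?thesis
        unfolding 1 by (auto simp: split_less_def intro!: exI[of _ "1::real"])
    next
      case 2
      show ?thesis
        unfolding 2 by (auto simp: split_less_def intro!: exI[of _ "split_proj a - t"])
    qed
  qed
  then show ?thesis using assms(2) that by blast
qed

lemma limitin_Plus_from_right:
  assumes t: "t \<in> \<Gamma>" and z: "\<And>n. z n \<in> split_reals \<Gamma>" "\<And>n. t < split_proj (z n)"
    and lim: "(\<lambda>n. split_proj (z n)) \<longlonglongrightarrow> t"
  shows "limitin (split_topology \<Gamma>) z (Plus t) sequentially"
  unfolding limitin_def
proof (intro conjI allI impI)
  show "Plus t \<in> topspace (split_topology \<Gamma>)" using t by (simp add: split_reals_def)
  fix U assume "openin (split_topology \<Gamma>) U \<and> Plus t \<in> U"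
  then obtain e where e: "e > 0"
    "\<And>x. x \<in> split_reals \<Gamma> \<Longrightarrow> t < split_proj x \<Longrightarrow> split_proj x < t + e \<Longrightarrow> x \<in> U"
    using right_neighbourhood_of_Plus by metis
  have "\<forall>\<^sub>F n in sequentially. split_proj (z n) < t + e"
    using order_tendstoD(2)[OF lim] e(1) by simp
  then show "\<forall>\<^sub>F n in sequentially. z n \<in> U"
    by (rule eventually_mono) (use e(2) z in blast)
qed

section \<open>Homomorphisms of transformation groupoids\<close>

lemma transformation_groupoid_simps [simp]:
  "gtop (transformation_groupoid X G act) = prod_topology X (discrete_topology (carrier G))"
  "grange (transformation_groupoid X G act) (x, \<gamma>) = (x, \<one>\<^bsub>G\<^esub>)"
  "gsource (transformation_groupoid X G act) (x, \<gamma>) = (act (inv\<^bsub>G\<^esub> \<gamma>) x, \<one>\<^bsub>G\<^esub>)"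
  "gmult (transformation_groupoid X G act) (x, \<gamma>) (y, \<gamma>') = (x, \<gamma> \<otimes>\<^bsub>G\<^esub> \<gamma>')"
  "arrows (transformation_groupoid X G act) = topspace X \<times> carrier G"
  by (simp_all add: transformation_groupoid_def arrows_def)

text \<open>A unit is idempotent, hence so is the group component of its image, which is therefore
  trivial. Multiplying an arrow on the left by the unit at its range then shows that the point
  component of the image depends on the point only; call it \<open>\<theta> x\<close>. The equivariance and the cocycle
  identity state that sources and products are preserved.\<close>

lemma cocycle_of_groupoid_hom:
  fixes G :: "('a, 'm) monoid_scheme" and H :: "('b, 'n) monoid_scheme"
  assumes G: "group G" and H: "group H"
    and one: "\<And>x. x \<in> topspace X \<Longrightarrow> act \<one>\<^bsub>G\<^esub> x = x"
    and closed: "\<And>\<gamma> x. \<gamma> \<in> carrier G \<Longrightarrow> x \<in> topspace X \<Longrightarrow> act \<gamma> x \<in> topspace X"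
    and hom: "groupoid_hom (transformation_groupoid X G act) (transformation_groupoid Y H act') \<Phi>"
  obtains \<theta> c where
    "\<And>x \<gamma>. x \<in> topspace X \<Longrightarrow> \<gamma> \<in> carrier G \<Longrightarrow> \<Phi> (x, \<gamma>) = (\<theta> x, c x \<gamma>)"
    "\<And>x. x \<in> topspace X \<Longrightarrow> \<theta> x \<in> topspace Y"
    "\<And>x \<gamma>. x \<in> topspace X \<Longrightarrow> \<gamma> \<in> carrier G \<Longrightarrow> c x \<gamma> \<in> carrier H"
    "\<And>x. x \<in> topspace X \<Longrightarrow> c x \<one>\<^bsub>G\<^esub> = \<one>\<^bsub>H\<^esub>"
    "\<And>x \<gamma>. x \<in> topspace X \<Longrightarrow> \<gamma> \<in> carrier G \<Longrightarrow>
       \<theta> (act (inv\<^bsub>G\<^esub> \<gamma>) x) = act' (inv\<^bsub>H\<^esub> (c x \<gamma>)) (\<theta> x)"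
    "\<And>x \<gamma> \<gamma>'. x \<in> topspace X \<Longrightarrow> \<gamma> \<in> carrier G \<Longrightarrow> \<gamma>' \<in> carrier G \<Longrightarrow>
       c x (\<gamma> \<otimes>\<^bsub>G\<^esub> \<gamma>') = c x \<gamma> \<otimes>\<^bsub>H\<^esub> c (act (inv\<^bsub>G\<^esub> \<gamma>) x) \<gamma>'"
proof -
  interpret G: group G by fact
  interpret H: group H by fact
  define \<theta> where "\<theta> x = fst (\<Phi> (x, \<one>\<^bsub>G\<^esub>))" for x
  define c where "c x \<gamma> = snd (\<Phi> (x, \<gamma>))" for x \<gamma>
  have range: "\<Phi> (x, \<gamma>) \<in> topspace Y \<times> carrier H" if "x \<in> topspace X" "\<gamma> \<in> carrier G" for x \<gamma>
    using hom that by (auto simp: groupoid_hom_def)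
  have c: "c x \<gamma> \<in> carrier H" if "x \<in> topspace X" "\<gamma> \<in> carrier G" for x \<gamma>
    using range[OF that] by (auto simp: c_def mem_Times_iff)
  have source: "act (inv\<^bsub>G\<^esub> \<gamma>) x \<in> topspace X" if "x \<in> topspace X" "\<gamma> \<in> carrier G" for x \<gamma>
    using that by (simp add: closed)
  have prod: "act' (inv\<^bsub>H\<^esub> (c x \<gamma>)) (fst (\<Phi> (x, \<gamma>))) = fst (\<Phi> (act (inv\<^bsub>G\<^esub> \<gamma>) x, \<gamma>'))"
      "\<Phi> (x, \<gamma> \<otimes>\<^bsub>G\<^esub> \<gamma>') = (fst (\<Phi> (x, \<gamma>)), c x \<gamma> \<otimes>\<^bsub>H\<^esub> c (act (inv\<^bsub>G\<^esub> \<gamma>) x) \<gamma>')"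
    if "x \<in> topspace X" "\<gamma> \<in> carrier G" "\<gamma>' \<in> carrier G" for x \<gamma> \<gamma>'
  proof -
    let ?S = "transformation_groupoid X G act" and ?T = "transformation_groupoid Y H act'"
    let ?x' = "act (inv\<^bsub>G\<^esub> \<gamma>) x"
    have comp: "composable ?S (x, \<gamma>) (?x', \<gamma>')"
      using that source by (simp add: composable_def)
    obtain u a where u: "\<Phi> (x, \<gamma>) = (u, a)" by fastforce
    obtain v b where v: "\<Phi> (?x', \<gamma>') = (v, b)" by fastforce
    have "composable ?T (u, a) (v, b) \<and> \<Phi> (gmult ?S (x, \<gamma>) (?x', \<gamma>')) = gmult ?T (u, a) (v, b)"
      using hom comp unfolding groupoid_hom_def by (metis u v)
    then show "act' (inv\<^bsub>H\<^esub> (c x \<gamma>)) (fst (\<Phi> (x, \<gamma>))) = fst (\<Phi> (?x', \<gamma>'))"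
      "\<Phi> (x, \<gamma> \<otimes>\<^bsub>G\<^esub> \<gamma>') = (fst (\<Phi> (x, \<gamma>)), c x \<gamma> \<otimes>\<^bsub>H\<^esub> c ?x' \<gamma>')"
      by (simp_all add: composable_def c_def u v)
  qed
  have split: "\<Phi> (x, \<gamma>) = (\<theta> x, c x \<gamma>)" if "x \<in> topspace X" "\<gamma> \<in> carrier G" for x \<gamma>
    using prod(2)[of x "\<one>\<^bsub>G\<^esub>" \<gamma>] that by (auto simp: \<theta>_def c_def prod_eq_iff)
  show ?thesis
  proof (rule that[of \<theta> c])
    fix x assume x: "x \<in> topspace X"
    show "\<theta> x \<in> topspace Y"
      using range[OF x G.one_closed] by (auto simp: \<theta>_def mem_Times_iff)
    have "c x \<one>\<^bsub>G\<^esub> \<otimes>\<^bsub>H\<^esub> c x \<one>\<^bsub>G\<^esub> = c x \<one>\<^bsub>G\<^esub>"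
      using arg_cong[OF prod(2)[OF x G.one_closed G.one_closed], of snd] x
      by (simp add: one flip: c_def)
    then show "c x \<one>\<^bsub>G\<^esub> = \<one>\<^bsub>H\<^esub>"
      using c[OF x G.one_closed] by simp
  next
    fix x \<gamma> assume x: "x \<in> topspace X" and \<gamma>: "\<gamma> \<in> carrier G"
    show "\<theta> (act (inv\<^bsub>G\<^esub> \<gamma>) x) = act' (inv\<^bsub>H\<^esub> (c x \<gamma>)) (\<theta> x)"
      using prod(1)[OF x \<gamma> G.one_closed] x \<gamma> by (simp add: split source)
    fix \<gamma>' assume \<gamma>': "\<gamma>' \<in> carrier G"
    show "c x (\<gamma> \<otimes>\<^bsub>G\<^esub> \<gamma>') = c x \<gamma> \<otimes>\<^bsub>H\<^esub> c (act (inv\<^bsub>G\<^esub> \<gamma>) x) \<gamma>'"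
      using prod(2)[OF x \<gamma> \<gamma>'] x \<gamma> \<gamma>' by (simp add: split)
  qed (fact split c)+
qed

text \<open>The group components are topologized discretely, so that continuity forces \<open>c\<close> to be locally
  constant in the point.\<close>

lemma locally_constant_cocycle:
  assumes cont: "continuous_map (prod_topology X (discrete_topology A))
      (prod_topology Y (discrete_topology B)) \<Phi>"
    and \<Phi>: "\<And>x \<gamma>. x \<in> topspace X \<Longrightarrow> \<gamma> \<in> A \<Longrightarrow> \<Phi> (x, \<gamma>) = (\<theta> x, c x \<gamma>)"
    and \<gamma>: "\<gamma> \<in> A"
  shows "continuous_map X Y \<theta>"
    and "x \<in> topspace X \<Longrightarrow> \<exists>U. openin X U \<and> x \<in> U \<and> (\<forall>z\<in>U. c z \<gamma> = c x \<gamma>)"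
proof -
  have "continuous_map X (prod_topology X (discrete_topology A)) (\<lambda>x. (x, \<gamma>))"
    using \<gamma> by (simp add: continuous_map_pairwise o_def)
  from continuous_map_compose[OF this cont]
  have pair: "continuous_map X (prod_topology Y (discrete_topology B)) (\<lambda>x. (\<theta> x, c x \<gamma>))"
    by (rule continuous_map_eq) (simp add: \<Phi> \<gamma>)
  then show "continuous_map X Y \<theta>"
    by (simp add: continuous_map_pairwise o_def)
  assume x: "x \<in> topspace X"
  have c: "continuous_map X (discrete_topology B) (\<lambda>x. c x \<gamma>)"
    using pair by (simp add: continuous_map_pairwise o_def)
  then have "c x \<gamma> \<in> B"
    using continuous_map_image_subset_topspace x by fastforce
  then have "openin X {z \<in> topspace X. c z \<gamma> \<in> {c x \<gamma>}}"
    by (intro openin_continuous_map_preimage[OF c]) simp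
  then show "\<exists>U. openin X U \<and> x \<in> U \<and> (\<forall>z\<in>U. c z \<gamma> = c x \<gamma>)"
    using x by (intro exI[of _ "{z \<in> topspace X. c z \<gamma> \<in> {c x \<gamma>}}"]) auto
qed

section \<open>Expansion at a fixed point is preserved\<close>

text \<open>Below the projection to the real line, the hypothesis on \<open>\<theta>\<close> turns the contraction by $1/l$
  near $0_+$ into an affine map with slope $1/m$ that fixes the projection of $\theta(0_+)$. The
  orbits of the former converge to $0_+$, so by continuity their images converge to this fixed
  point. An affine map has an orbit that converges to its fixed point without starting there only
  if its slope is below 1 in absolute value.\<close>

lemma expanding_cocycle_value:
  assumes \<Lambda>: "subgroup \<Lambda> pos_real_mult_group" and \<Gamma>: "Z_module \<Lambda> \<Gamma>"
    and l: "l \<in> \<Lambda>" "1 < l" and m: "0 < m"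
    and \<theta>: "continuous_map (split_topology \<Gamma>) (split_topology \<Gamma>') \<theta>"
    and inj: "inj_on \<theta> (split_reals \<Gamma>)"
    and U: "openin (split_topology \<Gamma>) U" "Plus 0 \<in> U"
    and equivariant: "\<And>x. x \<in> U \<Longrightarrow> \<theta> (split_act (0, 1 / l) x) = split_act (s, 1 / m) (\<theta> x)"
  shows "1 < m"
proof -
  obtain e where e: "e > 0"
    "\<And>x. x \<in> split_reals \<Gamma> \<Longrightarrow> 0 < split_proj x \<Longrightarrow> split_proj x < e \<Longrightarrow> x \<in> U"
    using right_neighbourhood_of_Plus[OF U] by auto
  define d where "d x = split_proj (\<theta> x) - split_proj (\<theta> (Plus 0))" for x
  have step: "d (split_act (0, 1 / l) x) = d x / m" if "x \<in> U" for x
  proof -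
    have "split_proj (\<theta> (Plus 0)) = split_proj (\<theta> (Plus 0)) / m + s"
      using arg_cong[OF equivariant[OF U(2)], of split_proj] by (simp add: split_proj_act)
    then show ?thesis
      using arg_cong[OF equivariant[OF that], of split_proj]
      by (simp add: d_def split_proj_act diff_divide_distrib)
  qed
  let ?I = "{x \<in> split_reals \<Gamma>. 0 < split_proj x \<and> split_proj x < e}"
  \<comment> \<open>The infinite set \<open>?I\<close> is mapped injectively, so it does not fit into one finite fibre.\<close>
  obtain x where x: "x \<in> ?I" "d x \<noteq> 0"
  proof (rule ccontr)
    assume "\<not> thesis"
    then have "\<theta> ` ?I \<subseteq> {z. split_proj z = split_proj (\<theta> (Plus 0))}"
      using that by (auto simp: d_def)
    then have "finite (\<theta> ` ?I)"
      by (rule finite_subset) (rule finite_split_proj_fibre)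
    moreover have "inj_on \<theta> ?I"
      by (rule inj_on_subset[OF inj]) auto
    ultimately have "finite ?I" by (rule finite_imageD)
    moreover have "{0<..<e} \<subseteq> split_proj ` ?I"
    proof
      fix a assume a: "a \<in> {0<..<e}"
      obtain z where "z \<in> split_reals \<Gamma>" "split_proj z = a"
        by (rule split_proj_surj)
      then show "a \<in> split_proj ` ?I" using a by (intro image_eqI[of _ _ z]) auto
    qed
    ultimately have "finite {0<..<e}"
      by (meson finite_imageI finite_subset)
    then show False using e(1) infinite_Ioo by blast
  qed
  define z where "z n = (split_act (0, 1 / l) ^^ n) x" for n
  have proj_z: "split_proj (z n) = split_proj x / l ^ n" for n
    using l by (induction n) (simp_all add: z_def split_proj_act)
  have z: "z n \<in> split_reals \<Gamma>" for n
  proof (induction n)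
    case 0
    then show ?case using x by (simp add: z_def)
  next
    case (Suc n)
    have "(0, 1 / l) \<in> carrier (semidirect \<Gamma> \<Lambda>)"
      using Z_moduleD(1)[OF \<Gamma>] pos_subgroup(4)[OF \<Lambda> l(1)] by simp
    from split_act_closed[OF \<Lambda> \<Gamma> this Suc.IH] show ?case by (simp add: z_def)
  qed
  have z_pos: "0 < split_proj (z n)" for n
    using x l by (simp add: proj_z)
  have "split_proj x / l ^ n \<le> split_proj x" for n
    using x l by (simp add: divide_le_eq mult_le_cancel_left1)
  then have z_U: "z n \<in> U" for n
    using x z z_pos by (intro e(2)) (auto simp: proj_z intro: le_less_trans)
  have d_z: "d (z n) = d x / m ^ n" for n
  proof (induction n)
    case 0
    then show ?case by (simp add: z_def)
  next
    case (Suc n)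
    have "d (z (Suc n)) = d (split_act (0, 1 / l) (z n))" by (simp add: z_def)
    also have "\<dots> = d x / m ^ Suc n" using step[OF z_U, of n] Suc.IH by simp
    finally show ?case .
  qed
  have "(\<lambda>n. split_proj (z n)) \<longlonglongrightarrow> 0"
    unfolding proj_z using LIMSEQ_divide_realpow_zero[OF l(2)] .
  then have "limitin (split_topology \<Gamma>) z (Plus 0) sequentially"
    using Z_moduleD(1)[OF \<Gamma>] z z_pos by (intro limitin_Plus_from_right)
  from continuous_map_limit[OF continuous_map_compose[OF \<theta> continuous_map_split_proj] this]
  have "(\<lambda>n. split_proj (\<theta> (z n))) \<longlonglongrightarrow> split_proj (\<theta> (Plus 0))"
    by (simp add: o_def)
  then have "(\<lambda>n. d (z n)) \<longlonglongrightarrow> 0"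
    unfolding d_def by (simp add: LIM_zero)
  then have lim: "(\<lambda>n. \<bar>d x\<bar> / m ^ n) \<longlonglongrightarrow> 0"
    using tendsto_rabs_zero m by (fastforce simp: d_z abs_divide)
  show ?thesis
  proof (rule ccontr)
    assume "\<not> 1 < m"
    then have "m ^ n \<le> 1" for n using m by (simp add: power_le_one)
    then have "\<bar>d x\<bar> \<le> \<bar>d x\<bar> / m ^ n" for n
      using m by (simp add: le_divide_eq mult_left_le)
    then have "\<bar>d x\<bar> \<le> 0"
      by (intro tendsto_lowerbound[OF lim]) auto
    then show False using x by simp
  qed
qed

section \<open>Order-preserving homomorphisms from the action at a split point\<close>

theorem lemma7p3:
  fixes \<Lambda>\<^sub>1 \<Lambda>\<^sub>2 \<Gamma>\<^sub>1 \<Gamma>\<^sub>2 :: "real set"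
    and \<Phi> :: "split_real \<times> real \<times> real \<Rightarrow> split_real \<times> real \<times> real"
  assumes "subgroup \<Lambda>\<^sub>1 pos_real_mult_group" and "countable \<Lambda>\<^sub>1"
    and "subgroup \<Lambda>\<^sub>2 pos_real_mult_group" and "countable \<Lambda>\<^sub>2"
    and "Z_module \<Lambda>\<^sub>1 \<Gamma>\<^sub>1" and "countable \<Gamma>\<^sub>1" and "closure \<Gamma>\<^sub>1 = UNIV"
    and "Z_module \<Lambda>\<^sub>2 \<Gamma>\<^sub>2" and "countable \<Gamma>\<^sub>2" and "closure \<Gamma>\<^sub>2 = UNIV"
    and "groupoid_hom (stein_groupoid \<Gamma>\<^sub>1 \<Lambda>\<^sub>1) (stein_groupoid \<Gamma>\<^sub>2 \<Lambda>\<^sub>2) \<Phi>"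
    and "continuous_map (gtop (stein_groupoid \<Gamma>\<^sub>1 \<Lambda>\<^sub>1)) (gtop (stein_groupoid \<Gamma>\<^sub>2 \<Lambda>\<^sub>2)) \<Phi>"
    and "inj_on \<Phi> (arrows (stein_groupoid \<Gamma>\<^sub>1 \<Lambda>\<^sub>1))"
    and "open_map (gtop (stein_groupoid \<Gamma>\<^sub>1 \<Lambda>\<^sub>1)) (gtop (stein_groupoid \<Gamma>\<^sub>2 \<Lambda>\<^sub>2)) \<Phi>"
  shows "\<exists>\<phi>. \<phi> \<in> hom (pos_real_mult_group\<lparr>carrier := \<Lambda>\<^sub>1\<rparr>) (pos_real_mult_group\<lparr>carrier := \<Lambda>\<^sub>2\<rparr>) \<and>
    (\<forall>l\<in>\<Lambda>\<^sub>1. \<forall>l'\<in>\<Lambda>\<^sub>1. \<phi> l < \<phi> l' \<longleftrightarrow> l < l')"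
proof -
  note \<Lambda>1 = assms(1) and \<Lambda>2 = assms(3) and \<Gamma>1 = assms(5) and \<Gamma>2 = assms(8)
  note zero = Z_moduleD(1)[OF \<Gamma>1] and one = pos_subgroup(2)[OF \<Lambda>1]
  let ?o = "Plus 0"
  have o: "?o \<in> split_reals \<Gamma>\<^sub>1" using zero by (simp add: split_reals_def)
  obtain \<theta> c where
    \<Phi>: "\<And>x \<gamma>. x \<in> split_reals \<Gamma>\<^sub>1 \<Longrightarrow> \<gamma> \<in> \<Gamma>\<^sub>1 \<times> \<Lambda>\<^sub>1 \<Longrightarrow> \<Phi> (x, \<gamma>) = (\<theta> x, c x \<gamma>)"
    and "\<And>x. x \<in> split_reals \<Gamma>\<^sub>1 \<Longrightarrow> \<theta> x \<in> split_reals \<Gamma>\<^sub>2"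
    and c: "\<And>x \<gamma>. x \<in> split_reals \<Gamma>\<^sub>1 \<Longrightarrow> \<gamma> \<in> \<Gamma>\<^sub>1 \<times> \<Lambda>\<^sub>1 \<Longrightarrow> c x \<gamma> \<in> \<Gamma>\<^sub>2 \<times> \<Lambda>\<^sub>2"
    and c_unit: "\<And>x. x \<in> split_reals \<Gamma>\<^sub>1 \<Longrightarrow> c x (0, 1) = (0, 1)"
    and equivariant: "\<And>x \<gamma>. x \<in> split_reals \<Gamma>\<^sub>1 \<Longrightarrow> \<gamma> \<in> \<Gamma>\<^sub>1 \<times> \<Lambda>\<^sub>1 \<Longrightarrow>
      \<theta> (split_act (inv\<^bsub>semidirect \<Gamma>\<^sub>1 \<Lambda>\<^sub>1\<^esub> \<gamma>) x) =
        split_act (inv\<^bsub>semidirect \<Gamma>\<^sub>2 \<Lambda>\<^sub>2\<^esub> (c x \<gamma>)) (\<theta> x)"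
    and cocycle: "\<And>x \<gamma> \<gamma>'. x \<in> split_reals \<Gamma>\<^sub>1 \<Longrightarrow> \<gamma> \<in> \<Gamma>\<^sub>1 \<times> \<Lambda>\<^sub>1 \<Longrightarrow> \<gamma>' \<in> \<Gamma>\<^sub>1 \<times> \<Lambda>\<^sub>1 \<Longrightarrow>
      c x (\<gamma> \<otimes>\<^bsub>semidirect \<Gamma>\<^sub>1 \<Lambda>\<^sub>1\<^esub> \<gamma>') =
        c x \<gamma> \<otimes>\<^bsub>semidirect \<Gamma>\<^sub>2 \<Lambda>\<^sub>2\<^esub> c (split_act (inv\<^bsub>semidirect \<Gamma>\<^sub>1 \<Lambda>\<^sub>1\<^esub> \<gamma>) x) \<gamma>'"
  proof (rule cocycle_of_groupoid_hom[OF group_semidirect[OF \<Lambda>1 \<Gamma>1]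
        group_semidirect[OF \<Lambda>2 \<Gamma>2] _ _ assms(11)[unfolded stein_groupoid_def],
        unfolded topspace_split_topology semidirect_simps(1,3)], goal_cases)
    case (1 x)
    then show ?case by (simp add: split_act_one)
  next
    case (2 \<gamma> x)
    then show ?case using split_act_closed[OF \<Lambda>1 \<Gamma>1] by simp
  next
    case (3 \<theta> c)
    show ?case by (rule 3(1)[OF 3(2-)])
  qed
  have cont: "continuous_map
      (prod_topology (split_topology \<Gamma>\<^sub>1) (discrete_topology (\<Gamma>\<^sub>1 \<times> \<Lambda>\<^sub>1)))
      (prod_topology (split_topology \<Gamma>\<^sub>2) (discrete_topology (\<Gamma>\<^sub>2 \<times> \<Lambda>\<^sub>2))) \<Phi>"
    using assms(12) by (simp add: stein_groupoid_def)
  have inj: "inj_on \<theta> (split_reals \<Gamma>\<^sub>1)"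
  proof (rule inj_onI)
    fix x y assume xy: "x \<in> split_reals \<Gamma>\<^sub>1" "y \<in> split_reals \<Gamma>\<^sub>1" "\<theta> x = \<theta> y"
    then have "\<Phi> (x, (0, 1)) = \<Phi> (y, (0, 1))"
      using zero one by (simp add: \<Phi> c_unit)
    then show "x = y"
      using inj_onD[OF assms(13), of "(x, (0, 1))" "(y, (0, 1))"] xy zero one
      by (simp add: stein_groupoid_def)
  qed
  \<comment> \<open>As \<open>?o\<close> is fixed by all $(0,\lambda)$, the cocycle identity is multiplicativity there.\<close>
  define \<phi> where "\<phi> l = snd (c ?o (0, l))" for l
  have \<phi>: "\<phi> l \<in> \<Lambda>\<^sub>2" if "l \<in> \<Lambda>\<^sub>1" for l
    using c[OF o, of "(0, l)"] that zero by (auto simp: \<phi>_def mem_Times_iff)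
  have inv: "inv\<^bsub>semidirect \<Gamma>\<^sub>1 \<Lambda>\<^sub>1\<^esub> (0, l) = (0, 1 / l)" if "l \<in> \<Lambda>\<^sub>1" for l
    using inv_semidirect[OF \<Lambda>1 \<Gamma>1 zero that] by simp
  have mult: "\<phi> (l * l') = \<phi> l * \<phi> l'" if "l \<in> \<Lambda>\<^sub>1" "l' \<in> \<Lambda>\<^sub>1" for l l'
  proof -
    have "c ?o (0, l * l') = c ?o (0, l) \<otimes>\<^bsub>semidirect \<Gamma>\<^sub>2 \<Lambda>\<^sub>2\<^esub> c ?o (0, l')"
      using cocycle[OF o, of "(0, l)" "(0, l')"] that zero by (simp add: inv)
    then show ?thesis
      by (cases "c ?o (0, l)"; cases "c ?o (0, l')") (simp add: \<phi>_def)
  qed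
  have above_one: "1 < \<phi> l" if l: "l \<in> \<Lambda>\<^sub>1" "1 < l" for l
  proof -
    have g: "(0, l) \<in> \<Gamma>\<^sub>1 \<times> \<Lambda>\<^sub>1" using l zero by simp
    obtain s where s: "c ?o (0, l) = (s, \<phi> l)" "s \<in> \<Gamma>\<^sub>2"
      using c[OF o g] by (auto simp: \<phi>_def mem_Times_iff prod_eq_iff)
    obtain U where U: "openin (split_topology \<Gamma>\<^sub>1) U" "?o \<in> U" "\<forall>x\<in>U. c x (0, l) = (s, \<phi> l)"
      using locally_constant_cocycle(2)[OF cont _ g] \<Phi> o s(1) by (metis topspace_split_topology)
    have "\<theta> (split_act (0, 1 / l) x) = split_act (- (s / \<phi> l), 1 / \<phi> l) (\<theta> x)" if "x \<in> U" for x
    proof -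
      have "x \<in> split_reals \<Gamma>\<^sub>1" using openin_subset[OF U(1)] that by auto
      from equivariant[OF this g] show ?thesis
        using U(3) that by (simp add: inv[OF l(1)] inv_semidirect[OF \<Lambda>2 \<Gamma>2 s(2) \<phi>[OF l(1)]])
    qed
    moreover have "continuous_map (split_topology \<Gamma>\<^sub>1) (split_topology \<Gamma>\<^sub>2) \<theta>"
      using locally_constant_cocycle(1)[OF cont _ g] \<Phi> by simp
    ultimately show ?thesis
      using expanding_cocycle_value[OF \<Lambda>1 \<Gamma>1 l pos_subgroup(1)[OF \<Lambda>2 \<phi>[OF l(1)]] _ inj U(1,2)]
      by blast
  qed
  \<comment> \<open>Apply the previous fact to the quotient \<open>l' / l\<close>.\<close>
  have mono: "\<phi> l < \<phi> l'" if l: "l \<in> \<Lambda>\<^sub>1" "l' \<in> \<Lambda>\<^sub>1" "l < l'" for l l'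
  proof -
    have pos: "0 < l" "0 < \<phi> l" using pos_subgroup(1) \<Lambda>1 \<Lambda>2 \<phi> l by blast+
    have q: "l' * (1 / l) \<in> \<Lambda>\<^sub>1" using l by (intro pos_subgroup[OF \<Lambda>1])
    have "\<phi> l' = \<phi> l * \<phi> (l' * (1 / l))"
      using mult[OF l(1) q] pos by simp
    moreover have "1 < \<phi> (l' * (1 / l))"
      using above_one[OF q] pos l(3) by simp
    ultimately show ?thesis using pos by simp
  qed
  have "\<phi> \<in> hom (pos_real_mult_group\<lparr>carrier := \<Lambda>\<^sub>1\<rparr>) (pos_real_mult_group\<lparr>carrier := \<Lambda>\<^sub>2\<rparr>)"
    using \<phi> mult by (auto simp: hom_def pos_real_mult_group_def)
  moreover have "\<phi> l < \<phi> l' \<longleftrightarrow> l < l'" if "l \<in> \<Lambda>\<^sub>1" "l' \<in> \<Lambda>\<^sub>1" for l l'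
    using mono[OF that] mono[OF that(2,1)] by (metis linorder_neqE_linordered_idom order_less_asym)
  ultimately show ?thesis by blast
qed

end
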